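(* Let $\chi\colon K^m\otimes K^n\longrightarrow K^n\otimes K^m$ be a standard twisting map and let $Q={}^{\chi}Q$ be its associated quiver. The twisted tensor product $K^n\otimes_\chi K^m$ is isomorphic, as an algebra, to the radical square zero algebra $KQ/\langle Q_1^2\rangle$, where $KQ$ is the path algebra of $Q$ and $\langle Q_1^2\rangle$ is the two-sided ideal generated by the paths of length two.
   Context: $K$ is a field, $m,n$ positive integers, $K^m,K^n$ are product algebras with canonical bases $\{e_i\}$, $\{f_j\}$; $\mathbf 1$ is the all-ones column vector. For unital $K$-algebras $A,C$, a twisting map of $C$ with $A$ is a $K$-linear map $\chi\colon C\otimes A\to A\otimes C$ such that $\chi\circ(\eta_C\otimes A)=A\otimes\eta_C$, $\chi\circ(C\otimes\eta_A)=\eta_A\otimes C$, $\chi\circ(\mu_C\otimes A)=(A\otimes\mu_C)\circ(\chi\otimes C)\circ(C\otimes\chi)$ and $\chi\circ(C\otimes\mu_A)=(\mu_A\otimes C)\circ(A\otimes\chi)\circ(\chi\otimes A)$. The algebra $A\otimes_\chi C$ is $A\otimes C$ with multiplication $(\mu_A\otimes\mu_C)\circ(A\otimes\chi\otimes C)$ and unit $1\otimes 1$. For a linear map $\chi\colon K^m\otimes K^n\to K^n\otimes K^m$ write $\chi(e_i\otimes f_j)=\sum_{k,l}\lambda_{ij}^{kl}f_k\otimes e_l$ and define $A_\chi(i,l)\in M_n(K)$, $B_\chi(j,k)\in M_m(K)$ by $A_\chi(i,l)_{kj}=\lambda_{ij}^{kl}=B_\chi(j,k)_{li}$. If $\chi$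 is a twisting map, then for each $l$ the $A_\chi(i,l)$, $1\le i\le m$, are orthogonal idempotents with sum the identity and $A_\chi(i,l)\mathbf 1=\delta_{il}\mathbf 1$. The support of a matrix is the set of positions of its non-zero entries. The twisting map $\chi$ is standard if for every $l\in\{1,\dots,m\}$ (every "column" $l$): (i) $A_\chi(l,l)$ is a $0,1$-matrix with exactly one entry $1$ in each row; (ii) $\operatorname{Supp}(A_\chi(i,l))\subseteq\operatorname{Supp}(A_\chi(l,l))\cup\operatorname{Supp}(\mathrm{id})$ for all $i$. For such $\chi$: $J_l(l)=\{j: A_\chi(l,l)_{jj}=1\}$; for $j\notin J_l(l)$ let $c_j(A_\chi(l,l))$ be the unique index $c$ with $A_\chi(l,l)_{jc}=1$, and let $i(j,l)$ be the unique index $i$ with $A_\chi(i,l)_{jj}=1$ (it exists and is unique). The quiver ${}^\chi Q$ has vertex set ${}^\chi Q_0=\{(j,i)\in\{1,\dots,n\}\times\{1,\dots,m\}: j\in J_i(i)\}$, arrow set ${}^\chi Q_1=\{\alpha_{jl}: 1\le l\le m,\ j\in\{1,\dots,n\}\setminus J_l(l)\}$, and source and target maps $s(\alpha_{jl})=(j,i(j,l))$, $t(\alpha_{jl})=(c_j(A_\chi(l,l)),l)$ (both are vertices). In the path algebra, paths are multiplied so that $s(\alpha)\cdot\alpha\cdot t(\alpha)=\alpha$ for each arrow $\alpha$ (vertices being viewed as idempotents). *)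

theory Defs
  imports
    "HOL-Analysis.Cartesian_Space"
    "HOL-Library.Poly_Mapping"
    "HOL-Algebra.QuotRing"
    "HOL-Algebra.Module"
    "Graph_Theory.Arc_Walk"
begin

section \<open>Tensor products of coordinate spaces\<close>

text \<open>
  The algebra $K^m$ is \<^typ>\<open>'k ^ 'm\<close> with its (library) componentwise ring structure and canonical
  basis \<^term>\<open>axis i 1\<close>.  The tensor product of \<^typ>\<open>'k ^ 'a\<close> and \<^typ>\<open>'k ^ 'b\<close> is modelled by
  \<^typ>\<open>'k ^ ('a \<times> 'b)\<close>; the coordinate at \<open>(i, j)\<close> is the coefficient of the pure tensor of the
  \<open>i\<close>-th and \<open>j\<close>-th basis vectors.  The lemmas below confirm the defining (universal) property.
\<close>

abbreviation lin :: "('k::field ^ 'a \<Rightarrow> 'k ^ 'b) \<Rightarrow> bool" where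
  "lin f \<equiv> Vector_Spaces.linear (*s) (*s) f"

definition tensor :: "'k::field ^ 'a \<Rightarrow> 'k ^ 'b \<Rightarrow> 'k ^ ('a \<times> 'b)" where
  "tensor x y = (\<chi> p. x $ fst p * y $ snd p)"

text \<open>The linear map determined by its values on pure tensors of basis vectors.\<close>

definition tensor_lift ::
  "('k::field ^ 'a \<Rightarrow> 'k ^ 'b \<Rightarrow> 'k ^ 'c) \<Rightarrow> 'k ^ ('a \<times> 'b) \<Rightarrow> 'k ^ 'c" where
  "tensor_lift b z = (\<Sum>i\<in>UNIV. \<Sum>j\<in>UNIV. (z $ (i, j)) *s b (axis i 1) (axis j 1))"

definition tensor_map ::
  "('k::field ^ 'a \<Rightarrow> 'k ^ 'c) \<Rightarrow> ('k ^ 'b \<Rightarrow> 'k ^ 'd) \<Rightarrow> 'k ^ ('a \<times> 'b) \<Rightarrow> 'k ^ ('c \<times> 'd)" where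
  "tensor_map f g = tensor_lift (\<lambda>x y. tensor (f x) (g y))"

definition assoc_r :: "'k::field ^ (('a::finite \<times> 'b::finite) \<times> 'c::finite) \<Rightarrow> 'k ^ ('a \<times> ('b \<times> 'c))" where
  "assoc_r z = vec_lambda (\<lambda>(a, b, c). z $ ((a, b), c))"

definition assoc_l :: "'k::field ^ ('a::finite \<times> ('b::finite \<times> 'c::finite)) \<Rightarrow> 'k ^ (('a \<times> 'b) \<times> 'c)" where
  "assoc_l z = vec_lambda (\<lambda>((a, b), c). z $ (a, b, c))"

text \<open>The multiplication map of the product algebra, as a linear map on the tensor square.\<close>

definition mu :: "'k::field ^ ('a \<times> 'a) \<Rightarrow> 'k ^ 'a" where
  "mu = tensor_lift (*)"

lemma tensor_lift_linear: "lin (tensor_lift b)"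
  by unfold_locales
    (simp_all add: tensor_lift_def sum.distrib vec.scale_left_distrib vec.scale_sum_right
      vec.scale_scale)

lemma lin_sum_scale: "lin f \<Longrightarrow> f (\<Sum>i\<in>S. c i *s v i) = (\<Sum>i\<in>S. c i *s f (v i))"
  by (simp add: vec.linear_sum vec.linear_scale)

lemma lin_expand: "lin f \<Longrightarrow> f x = (\<Sum>i\<in>UNIV. (x $ i) *s f (axis i 1))"
  using lin_sum_scale[of f "\<lambda>i. x $ i" "\<lambda>i. axis i 1" UNIV] by (simp add: basis_expansion)

lemma tensor_lift_tensor:
  assumes "\<And>y. lin (\<lambda>x. b x y)" and "\<And>x. lin (b x)"
  shows "tensor_lift b (tensor x y) = b x y"
proof -
  have "b x y = (\<Sum>i\<in>UNIV. (x $ i) *s b (axis i 1) y)"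
    by (rule lin_expand[OF assms(1)])
  also have "\<dots> = (\<Sum>i\<in>UNIV. (x $ i) *s (\<Sum>j\<in>UNIV. (y $ j) *s b (axis i 1) (axis j 1)))"
    by (intro sum.cong refl arg_cong2[where f = "(*s)"] lin_expand assms(2))
  finally show ?thesis
    by (simp add: tensor_lift_def tensor_def vec.scale_sum_right vec.scale_scale)
qed

lemma tensor_linear_left: "lin (\<lambda>x. tensor x y)"
  by unfold_locales (simp_all add: tensor_def vec_eq_iff algebra_simps)

lemma tensor_linear_right: "lin (tensor x)"
  by unfold_locales (simp_all add: tensor_def vec_eq_iff algebra_simps)

lemma lin_comp: "lin f \<Longrightarrow> lin g \<Longrightarrow> lin (\<lambda>x. g (f x))"
  using Vector_Spaces.linear_compose[of "(*s)" "(*s)" f "(*s)" g] by (simp add: o_def)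

lemma tensor_map_tensor:
  assumes "lin f" "lin g"
  shows "tensor_map f g (tensor x y) = tensor (f x) (g y)"
  unfolding tensor_map_def
  by (rule tensor_lift_tensor)
    (use assms lin_comp tensor_linear_left tensor_linear_right in blast)+

lemma tensor_map_linear: "lin (tensor_map f g)"
  unfolding tensor_map_def by (rule tensor_lift_linear)

lemma tensor_axis: "tensor (axis i 1) (axis j 1) = axis (i, j) 1"
  by (auto simp: tensor_def axis_def vec_eq_iff)

lemma tensor_ext:
  assumes "lin f" "lin g" and "\<And>x y. f (tensor x y) = g (tensor x y)"
  shows "f = g"
proof
  fix z
  have "f (axis p 1) = g (axis p 1)" for p
    using assms(3)[of "axis (fst p) 1" "axis (snd p) 1"] by (simp add: tensor_axis)
  then show "f z = g z"
    by (simp add: lin_expand[OF assms(1), of z] lin_expand[OF assms(2), of z])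
qed

lemma assoc_r_tensor: "assoc_r (tensor (tensor x y) z) = tensor x (tensor y z)"
  by (simp add: assoc_r_def tensor_def vec_eq_iff algebra_simps)

lemma assoc_l_tensor: "assoc_l (tensor x (tensor y z)) = tensor (tensor x y) z"
  by (simp add: assoc_l_def tensor_def vec_eq_iff algebra_simps)

lemma mu_tensor: "mu (tensor x y) = x * y"
  unfolding mu_def
  by (rule tensor_lift_tensor; unfold_locales) (simp_all add: vec_eq_iff algebra_simps)


section \<open>Twisting maps\<close>

text \<open>
  Here $C = K^m$ and $A = K^n$.  The unit conditions are written on elements, i.e. with the
  canonical identification of a space with its tensor product with $K$.
\<close>

definition twisting_map :: "('k::field ^ ('m::finite \<times> 'n::finite) \<Rightarrow> 'k ^ ('n \<times> 'm)) \<Rightarrow> bool" where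
  "twisting_map tw \<longleftrightarrow>
     lin tw \<and>
     (\<forall>a. tw (tensor 1 a) = tensor a 1) \<and>
     (\<forall>c. tw (tensor c 1) = tensor 1 c) \<and>
     tw \<circ> tensor_map mu id
       = tensor_map id mu \<circ> assoc_r \<circ> tensor_map tw id \<circ> assoc_l \<circ> tensor_map id tw \<circ> assoc_r \<and>
     tw \<circ> tensor_map id mu
       = tensor_map mu id \<circ> assoc_l \<circ> tensor_map id tw \<circ> assoc_r \<circ> tensor_map tw id \<circ> assoc_l"

text \<open>The multiplication map of the twisted tensor product.\<close>

definition twisted_mu ::
  "('k::field ^ ('m::finite \<times> 'n::finite) \<Rightarrow> 'k ^ ('n \<times> 'm)) \<Rightarrow> 'k ^ (('n \<times> 'm) \<times> ('n \<times> 'm)) \<Rightarrow> 'k ^ ('n \<times> 'm)"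
where
  "twisted_mu tw =
     tensor_map mu mu \<circ> assoc_l \<circ> tensor_map id assoc_r
       \<circ> tensor_map id (tensor_map tw id)
       \<circ> tensor_map id assoc_l \<circ> assoc_r"

text \<open>
  A possibly non-commutative $K$-algebra is represented by a \<^type>\<open>module\<close> record (ring operations
  plus scalar multiplication), the scalars being a type of class \<^class>\<open>field\<close>.
\<close>

definition twisted_tensor_product ::
  "('k::field ^ ('m::finite \<times> 'n::finite) \<Rightarrow> 'k ^ ('n \<times> 'm)) \<Rightarrow> ('k, 'k ^ ('n \<times> 'm)) module" where
  "twisted_tensor_product tw =
     \<lparr>carrier = UNIV, mult = (\<lambda>x y. twisted_mu tw (tensor x y)), one = tensor 1 1,
      zero = 0, add = (+), smult = (*s)\<rparr>"

definition A_mat :: "('k::field ^ ('m::finite \<times> 'n::finite) \<Rightarrow> 'k ^ ('n \<times> 'm)) \<Rightarrow> 'm \<Rightarrow> 'm \<Rightarrow> 'k ^ 'n ^ 'n" where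
  "A_mat tw i l = (\<chi> k j. tw (tensor (axis i 1) (axis j 1)) $ (k, l))"

lemma lin_id: "lin id"
  by unfold_locales simp_all

lemma assoc_r_linear: "lin assoc_r"
  by unfold_locales (simp_all add: assoc_r_def vec_eq_iff)

lemma assoc_l_linear: "lin assoc_l"
  by unfold_locales (simp_all add: assoc_l_def vec_eq_iff)

lemma mu_linear: "lin mu"
  unfolding mu_def by (rule tensor_lift_linear)

text \<open>The structure constants of the twisted tensor product are the entries of the $A_\chi(i,l)$.\<close>

lemma twisted_tensor_product_basis:
  fixes tw :: "'a::field ^ ('c::finite \<times> 'b::finite) \<Rightarrow> 'a ^ ('b \<times> 'c)"
  assumes "lin tw"
  shows "tensor (axis j 1) (axis i 1) \<otimes>\<^bsub>twisted_tensor_product tw\<^esub> tensor (axis k 1) (axis l 1)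
       = (A_mat tw i l $ j $ k) *s tensor (axis j 1) (axis l 1)"
proof -
  note lins = lin_id assoc_r_linear assoc_l_linear mu_linear tensor_map_linear assms
  let ?w = "tw (tensor (axis i 1) (axis k 1))"
  define L where "L w = tensor_map mu mu (assoc_l (tensor_map id assoc_r
    (tensor (axis j 1) (tensor w (axis l 1)))))" for w :: "'a ^ ('b \<times> 'c)"
  have "lin L"
    unfolding L_def[abs_def]
    by (intro lin_comp[OF _ tensor_map_linear] lin_comp[OF _ assoc_l_linear]
        lin_comp[OF _ tensor_linear_right] tensor_linear_left)
  have L: "L (tensor x y) = tensor (axis j 1 * x) (y * axis l 1)" for x y
    by (simp add: L_def tensor_map_tensor lins assoc_r_tensor assoc_l_tensor mu_tensor)
  have ax: "axis a 1 * axis b (1::'a) = (if a = b then axis a 1 else 0)" for a b :: "'b"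
    by (auto simp: axis_def vec_eq_iff)
  have ax': "axis a 1 * axis b (1::'a) = (if a = b then axis a 1 else 0)" for a b :: "'c"
    by (auto simp: axis_def vec_eq_iff)
  have t0: "tensor 0 y = 0" "tensor x 0 = 0" for x :: "'a ^ 'b" and y :: "'a ^ 'c"
    by (simp_all add: tensor_def vec_eq_iff)
  have "tensor (axis j 1) (axis i 1) \<otimes>\<^bsub>twisted_tensor_product tw\<^esub> tensor (axis k 1) (axis l 1) = L ?w"
    by (simp add: twisted_tensor_product_def twisted_mu_def L_def tensor_map_tensor lins
        assoc_r_tensor assoc_l_tensor)
  also have "\<dots> = (\<Sum>p\<in>UNIV. (?w $ p) *s L (axis p 1))"
    by (rule lin_expand) fact
  also have "\<dots> = (\<Sum>p\<in>UNIV. if p = (j, l) then (?w $ p) *s tensor (axis j 1) (axis l 1) else 0)"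
  proof (intro sum.cong refl)
    fix p :: "'b \<times> 'c"
    show "(?w $ p) *s L (axis p 1)
        = (if p = (j, l) then (?w $ p) *s tensor (axis j 1) (axis l 1) else 0)"
      using L[of "axis (fst p) 1" "axis (snd p) 1"]
      by (cases p) (auto simp: tensor_axis[symmetric] ax ax' t0)
  qed
  finally show ?thesis
    by (simp add: A_mat_def)
qed

definition Supp :: "'k::zero ^ 'b ^ 'a \<Rightarrow> ('a \<times> 'b) set" where
  "Supp M = {(k, j). M $ k $ j \<noteq> 0}"

definition standard_twisting_map :: "('k::field ^ ('m::finite \<times> 'n::finite) \<Rightarrow> 'k ^ ('n \<times> 'm)) \<Rightarrow> bool" where
  "standard_twisting_map tw \<longleftrightarrow>
     twisting_map tw \<and>
     (\<forall>l. (\<forall>k j. A_mat tw l l $ k $ j \<in> {0, 1}) \<and>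
          (\<forall>k. \<exists>!j. A_mat tw l l $ k $ j = 1) \<and>
          (\<forall>i. Supp (A_mat tw i l) \<subseteq> Supp (A_mat tw l l) \<union> Supp (mat 1 :: 'k ^ 'n ^ 'n)))"


section \<open>The quiver of a standard twisting map\<close>

definition J_set :: "('k::field ^ ('m::finite \<times> 'n::finite) \<Rightarrow> 'k ^ ('n \<times> 'm)) \<Rightarrow> 'm \<Rightarrow> 'n set" where
  "J_set tw l = {j. A_mat tw l l $ j $ j = 1}"

definition c_idx :: "('k::field ^ ('m::finite \<times> 'n::finite) \<Rightarrow> 'k ^ ('n \<times> 'm)) \<Rightarrow> 'n \<Rightarrow> 'm \<Rightarrow> 'n" where
  "c_idx tw j l = (THE c. A_mat tw l l $ j $ c = 1)"

definition i_idx :: "('k::field ^ ('m::finite \<times> 'n::finite) \<Rightarrow> 'k ^ ('n \<times> 'm)) \<Rightarrow> 'n \<Rightarrow> 'm \<Rightarrow> 'm" where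
  "i_idx tw j l = (THE i. A_mat tw i l $ j $ j = 1)"

text \<open>The arrow $\alpha_{jl}$ is encoded by the pair \<open>(j, l)\<close>.\<close>

definition quiver ::
  "('k::field ^ ('m::finite \<times> 'n::finite) \<Rightarrow> 'k ^ ('n \<times> 'm)) \<Rightarrow> ('n \<times> 'm, 'n \<times> 'm) pre_digraph" where
  "quiver tw =
     \<lparr>verts = {(j, i). j \<in> J_set tw i},
      arcs = {(j, l). j \<notin> J_set tw l},
      tail = (\<lambda>(j, l). (j, i_idx tw j l)),
      head = (\<lambda>(j, l). (c_idx tw j l, l))\<rparr>"


section \<open>Path algebras\<close>

text \<open>
  A path is a pair of its start vertex and its list of arrows; the empty list gives the trivial
  path at a vertex.  Paths are composed from left to right.
\<close>

definition paths :: "('v, 'e) pre_digraph \<Rightarrow> ('v \<times> 'e list) set" where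
  "paths Q = {(u, p). \<exists>v. pre_digraph.awalk Q u p v}"

definition path_end :: "('v, 'e) pre_digraph \<Rightarrow> 'v \<times> 'e list \<Rightarrow> 'v" where
  "path_end Q x = last (pre_digraph.awalk_verts Q (fst x) (snd x))"

definition path_mult ::
  "('v, 'e) pre_digraph \<Rightarrow> ('v \<times> 'e list \<Rightarrow>\<^sub>0 'k::field) \<Rightarrow> ('v \<times> 'e list \<Rightarrow>\<^sub>0 'k)
     \<Rightarrow> ('v \<times> 'e list \<Rightarrow>\<^sub>0 'k)" where
  "path_mult Q f g =
     (\<Sum>x\<in>Poly_Mapping.keys f. \<Sum>y\<in>Poly_Mapping.keys g.
        if path_end Q x = fst y
        then Poly_Mapping.single (fst x, snd x @ snd y)
               (Poly_Mapping.lookup f x * Poly_Mapping.lookup g y)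
        else 0)"

text \<open>For a quiver with finitely many vertices; the unit is the sum of the trivial paths.\<close>

definition path_algebra ::
  "('v, 'e) pre_digraph \<Rightarrow> ('k::field, 'v \<times> 'e list \<Rightarrow>\<^sub>0 'k) module" where
  "path_algebra Q =
     \<lparr>carrier = {f. Poly_Mapping.keys f \<subseteq> paths Q}, mult = path_mult Q,
      one = (\<Sum>v\<in>verts Q. Poly_Mapping.single (v, []) 1),
      zero = 0, add = (+), smult = (\<lambda>c. Poly_Mapping.map ((*) c))\<rparr>"

definition quot_algebra :: "('k, 'a) module \<Rightarrow> 'a set \<Rightarrow> ('k, 'a set) module" where
  "quot_algebra A I =
     \<lparr>carrier = carrier (A Quot I), mult = mult (A Quot I), one = one (A Quot I),
      zero = zero (A Quot I), add = add (A Quot I),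
      smult = (\<lambda>c X. \<Union>x\<in>X. I +>\<^bsub>A\<^esub> (c \<odot>\<^bsub>A\<^esub> x))\<rparr>"

definition rad_square_zero_algebra ::
  "('v, 'e) pre_digraph \<Rightarrow> ('k::field, ('v \<times> 'e list \<Rightarrow>\<^sub>0 'k) set) module" where
  "rad_square_zero_algebra Q =
     quot_algebra (path_algebra Q)
       (Idl\<^bsub>path_algebra Q\<^esub> {Poly_Mapping.single x 1 | x. x \<in> paths Q \<and> length (snd x) = 2})"

definition algebra_isomorphic :: "('k, 'a) module \<Rightarrow> ('k, 'b) module \<Rightarrow> bool" where
  "algebra_isomorphic A B \<longleftrightarrow>
     (\<exists>h \<in> ring_iso A B. \<forall>c. \<forall>x \<in> carrier A. h (c \<odot>\<^bsub>A\<^esub> x) = c \<odot>\<^bsub>B\<^esub> h x)"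


subsection \<open>The path algebra of a finite quiver is a ring\<close>

lemma path_end_simp: "path_end Q (u, p) = (if p = [] then u else head Q (last p))"
proof (induction p arbitrary: u)
  case Nil
  then show ?case
    by (simp add: path_end_def pre_digraph.awalk_verts.simps)
next
  case (Cons e p)
  have "pre_digraph.awalk_verts Q v p \<noteq> []" for v
    by (cases p) (simp_all add: pre_digraph.awalk_verts.simps)
  then show ?case
    using Cons[of "head Q e"] by (simp add: path_end_def pre_digraph.awalk_verts.simps)
qed

definition path_term ::
  "('v, 'e) pre_digraph \<Rightarrow> 'v \<times> 'e list \<Rightarrow> 'v \<times> 'e list \<Rightarrow> 'k::field \<Rightarrow> ('v \<times> 'e list \<Rightarrow>\<^sub>0 'k)" where
  "path_term Q x y c =
     (if path_end Q x = fst y then Poly_Mapping.single (fst x, snd x @ snd y) c else 0)"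

lemma path_term_add: "path_term Q x y (c + d) = path_term Q x y c + path_term Q x y d"
  by (simp add: path_term_def single_add)

lemma path_term_zero [simp]: "path_term Q x y 0 = 0"
  by (simp add: path_term_def)

lemma path_mult_superset:
  assumes "finite X" "finite Y" "Poly_Mapping.keys f \<subseteq> X" "Poly_Mapping.keys g \<subseteq> Y"
  shows "path_mult Q f g =
    (\<Sum>x\<in>X. \<Sum>y\<in>Y. path_term Q x y (Poly_Mapping.lookup f x * Poly_Mapping.lookup g y))"
proof -
  have "path_mult Q f g = (\<Sum>x\<in>Poly_Mapping.keys f. \<Sum>y\<in>Poly_Mapping.keys g.
      path_term Q x y (Poly_Mapping.lookup f x * Poly_Mapping.lookup g y))"
    unfolding path_mult_def path_term_def by simp
  also have "\<dots> = (\<Sum>x\<in>Poly_Mapping.keys f. \<Sum>y\<in>Y.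
      path_term Q x y (Poly_Mapping.lookup f x * Poly_Mapping.lookup g y))"
    by (intro sum.cong refl sum.mono_neutral_left assms) (simp add: in_keys_iff)
  also have "\<dots> = (\<Sum>x\<in>X. \<Sum>y\<in>Y.
      path_term Q x y (Poly_Mapping.lookup f x * Poly_Mapping.lookup g y))"
    by (intro sum.mono_neutral_left assms) (simp add: in_keys_iff)
  finally show ?thesis .
qed

lemma path_mult_add_left: "path_mult Q (f + f') g = path_mult Q f g + path_mult Q f' g"
proof -
  let ?X = "Poly_Mapping.keys f \<union> Poly_Mapping.keys f'"
  show ?thesis
    using Poly_Mapping.keys_add[of f f']
    by (simp add: path_mult_superset[of ?X "Poly_Mapping.keys g"] lookup_add distrib_right
        path_term_add sum.distrib)
qed

lemma path_mult_add_right: "path_mult Q f (g + g') = path_mult Q f g + path_mult Q f g'"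
proof -
  let ?Y = "Poly_Mapping.keys g \<union> Poly_Mapping.keys g'"
  show ?thesis
    using Poly_Mapping.keys_add[of g g']
    by (simp add: path_mult_superset[of "Poly_Mapping.keys f" ?Y] lookup_add distrib_left
        path_term_add sum.distrib)
qed

lemma path_mult_zero [simp]: "path_mult Q 0 g = 0" "path_mult Q f 0 = 0"
  by (simp_all add: path_mult_def)

lemma path_mult_sum_left: "path_mult Q (\<Sum>i\<in>S. f i) g = (\<Sum>i\<in>S. path_mult Q (f i) g)"
  by (induction S rule: infinite_finite_induct) (simp_all add: path_mult_add_left)

lemma path_mult_sum_right: "path_mult Q f (\<Sum>i\<in>S. g i) = (\<Sum>i\<in>S. path_mult Q f (g i))"
  by (induction S rule: infinite_finite_induct) (simp_all add: path_mult_add_right)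

lemma path_mult_single:
  "path_mult Q (Poly_Mapping.single x c) (Poly_Mapping.single y d) = path_term Q x y (c * d)"
  by (simp add: path_mult_superset[of "{x}" "{y}"])

lemma poly_mapping_span_induct:
  assumes "Poly_Mapping.keys f \<subseteq> S" "P 0" "\<And>f g. P f \<Longrightarrow> P g \<Longrightarrow> P (f + g)"
    "\<And>x c. x \<in> S \<Longrightarrow> P (Poly_Mapping.single x c)"
  shows "P (f :: 'a \<Rightarrow>\<^sub>0 'k::field)"
proof -
  have "f = (\<Sum>x\<in>Poly_Mapping.keys f. Poly_Mapping.single x (Poly_Mapping.lookup f x))"
    by (rule poly_mapping_eqI) (simp add: lookup_sum lookup_single when_def in_keys_iff)
  moreover have "P (\<Sum>x\<in>X. Poly_Mapping.single x (h x))" if "X \<subseteq> S" for X and h :: "'a \<Rightarrow> 'k"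
    using that by (induction X rule: infinite_finite_induct) (auto simp: assms)
  ultimately show ?thesis
    using assms(1) by metis
qed

lemma path_mult_assoc_single:
  "path_mult Q (path_mult Q (Poly_Mapping.single x a) (Poly_Mapping.single y b)) (Poly_Mapping.single z c)
   = path_mult Q (Poly_Mapping.single x a) (path_mult Q (Poly_Mapping.single y b) (Poly_Mapping.single z c))"
  by (cases x; cases y; cases z)
    (auto simp: path_mult_single path_term_def path_end_simp mult.assoc)

lemma path_mult_assoc: "path_mult Q (path_mult Q f g) h = path_mult Q f (path_mult Q g h)"
proof (rule poly_mapping_span_induct[of f UNIV]; simp add: path_mult_add_left)
  fix x a
  show "path_mult Q (path_mult Q (Poly_Mapping.single x a) g) h
      = path_mult Q (Poly_Mapping.single x a) (path_mult Q g h)"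
  proof (rule poly_mapping_span_induct[of g UNIV];
      simp add: path_mult_add_left path_mult_add_right)
    fix y b
    show "path_mult Q (path_mult Q (Poly_Mapping.single x a) (Poly_Mapping.single y b)) h
        = path_mult Q (Poly_Mapping.single x a) (path_mult Q (Poly_Mapping.single y b) h)"
      by (rule poly_mapping_span_induct[of h UNIV];
          simp add: path_mult_add_right path_mult_assoc_single)
  qed
qed

lemma paths_append:
  assumes "wf_digraph Q" "x \<in> paths Q" "y \<in> paths Q" "path_end Q x = fst y"
  shows "(fst x, snd x @ snd y) \<in> paths Q"
proof -
  interpret wf_digraph Q by fact
  obtain v w where v: "awalk (fst x) (snd x) v" and w: "awalk (fst y) (snd y) w"
    using assms(2,3) by (auto simp: paths_def)
  have "v = fst y"
    using awlast_of_awalk[OF v] v assms(4) by (simp add: path_end_def)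
  then have "awalk (fst x) (snd x @ snd y) w"
    using v w by (intro awalk_appendI[of _ _ v]) simp_all
  then show ?thesis
    by (auto simp: paths_def)
qed

lemma path_mult_closed:
  assumes "wf_digraph Q" "Poly_Mapping.keys f \<subseteq> paths Q" "Poly_Mapping.keys g \<subseteq> paths Q"
  shows "Poly_Mapping.keys (path_mult Q f g) \<subseteq> paths Q"
proof -
  have "Poly_Mapping.keys (path_mult Q f g) \<subseteq>
    (\<Union>x\<in>Poly_Mapping.keys f. \<Union>y\<in>Poly_Mapping.keys g.
      Poly_Mapping.keys (path_term Q x y (Poly_Mapping.lookup f x * Poly_Mapping.lookup g y)))"
    unfolding path_mult_def path_term_def[symmetric]
    by (intro order_trans[OF Poly_Mapping.keys_sum] UN_mono order_refl)
  also have "\<dots> \<subseteq> paths Q"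
  proof (intro UN_least)
    fix x y assume "x \<in> Poly_Mapping.keys f" "y \<in> Poly_Mapping.keys g"
    then have "path_end Q x = fst y \<Longrightarrow> (fst x, snd x @ snd y) \<in> paths Q"
      using paths_append[OF assms(1), of x y] assms(2,3) by blast
    then show "Poly_Mapping.keys (path_term Q x y
        (Poly_Mapping.lookup f x * Poly_Mapping.lookup g y)) \<subseteq> paths Q"
      by (simp add: path_term_def)
  qed
  finally show ?thesis .
qed

lemma path_ends_in_verts:
  assumes "wf_digraph Q" "x \<in> paths Q"
  shows "fst x \<in> verts Q" "path_end Q x \<in> verts Q"
proof -
  interpret wf_digraph Q by fact
  obtain v where v: "awalk (fst x) (snd x) v"
    using assms(2) by (auto simp: paths_def)
  then show "fst x \<in> verts Q" by (simp add: awalk_def)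
  have "path_end Q x = v" using v by (simp add: path_end_def)
  then show "path_end Q x \<in> verts Q" using v by (auto dest: awalk_last_in_verts)
qed

theorem path_algebra_ring:
  assumes "fin_digraph Q"
  shows "ring (path_algebra Q :: ('k::field, _) module)"
proof -
  interpret fin_digraph Q by fact
  have wf: "wf_digraph Q" by unfold_locales
  let ?e = "\<Sum>v\<in>verts Q. Poly_Mapping.single (v, []) (1 :: 'k)"
  have one: "Poly_Mapping.keys ?e \<subseteq> paths Q"
    by (rule order_trans[OF Poly_Mapping.keys_sum]) (auto simp: paths_def awalk_def)
  have l1: "path_mult Q ?e f = f" if "Poly_Mapping.keys f \<subseteq> paths Q" for f
  proof -
    have step: "path_mult Q ?e (Poly_Mapping.single x c) = Poly_Mapping.single x c" if "x \<in> paths Q" for x c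
      using path_ends_in_verts[OF wf that]
      by (cases x) (simp add: path_mult_sum_left path_mult_single path_term_def path_end_simp)
    show ?thesis
      by (rule poly_mapping_span_induct[OF that]) (simp_all add: path_mult_add_right step)
  qed
  have r1: "path_mult Q f ?e = f" if "Poly_Mapping.keys f \<subseteq> paths Q" for f
  proof -
    have step: "path_mult Q (Poly_Mapping.single x c) ?e = Poly_Mapping.single x c" if "x \<in> paths Q" for x c
      using path_ends_in_verts[OF wf that]
      by (cases x) (simp add: path_mult_sum_right path_mult_single path_term_def)
    show ?thesis
      by (rule poly_mapping_span_induct[OF that]) (simp_all add: path_mult_add_left step)
  qed
  show ?thesis
  proof (rule ringI)
    show "abelian_group (path_algebra Q :: ('k, _) module)"
    proof (rule abelian_groupI)
      fix x y z :: "'a \<times> 'b list \<Rightarrow>\<^sub>0 'k"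
      let ?R = "path_algebra Q :: ('k, _) module"
      show "\<zero>\<^bsub>?R\<^esub> \<in> carrier ?R"
        by (simp add: path_algebra_def)
      show "\<zero>\<^bsub>?R\<^esub> \<oplus>\<^bsub>?R\<^esub> x = x"
        by (simp add: path_algebra_def)
      show "x \<oplus>\<^bsub>?R\<^esub> y = y \<oplus>\<^bsub>?R\<^esub> x"
        by (simp add: path_algebra_def add.commute)
      show "(x \<oplus>\<^bsub>?R\<^esub> y) \<oplus>\<^bsub>?R\<^esub> z = x \<oplus>\<^bsub>?R\<^esub> (y \<oplus>\<^bsub>?R\<^esub> z)"
        by (simp add: path_algebra_def add.assoc)
      assume x: "x \<in> carrier ?R"
      then show "\<exists>y\<in>carrier ?R. y \<oplus>\<^bsub>?R\<^esub> x = \<zero>\<^bsub>?R\<^esub>"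
        by (intro bexI[of _ "- x"]) (simp_all add: path_algebra_def)
      assume "y \<in> carrier ?R"
      with x show "x \<oplus>\<^bsub>?R\<^esub> y \<in> carrier ?R"
        using Poly_Mapping.keys_add[of x y] by (auto simp: path_algebra_def)
    qed
    show "Group.monoid (path_algebra Q :: ('k, _) module)"
      by (rule monoidI)
        (use path_mult_closed[OF wf] one l1 r1 in \<open>simp_all add: path_algebra_def path_mult_assoc\<close>)
  qed (auto simp: path_algebra_def path_mult_add_left path_mult_add_right)
qed

end

theory Submission
  imports Defs
begin

text \<open>
  Write $x_{ji} = f_j \otimes e_i$, so that $x_{ji} x_{kl} = A(i,l)_{jk}\, x_{jl}$.  The twisting
  conditions force the rows of the $A(i,l)$ of a standard twisting map into a closed form: row $j$
  is zero unless $i = l$, where it is the unit row at $c_j(l)$, or $j \notin J_l(l)$ and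
  $i = i(j,l)$, where it is the unit row at $j$ minus the unit row at $c_j(l)$
  (\<open>A_mat_row_J\<close>, \<open>A_mat_row_not_J\<close>).  Every index pair is either a vertex or (the label of) an
  arrow of the quiver, and the closed form says that, in coordinates,
  \[ (xy)_v = x_v y_v, \qquad (xy)_\alpha = x_\alpha y_{t(\alpha)}
       + x_{s(\alpha)} (y_\alpha - y_{t(\alpha)}) \]
  for vertices $v$ and arrows $\alpha$ (\<open>twisted_mult_vertex\<close>, \<open>twisted_mult_arrow\<close>).

  The basis elements $x_v$ at the vertices are idempotent but not orthogonal, since
  $x_{s(\alpha)} x_{t(\alpha)} = - x_\alpha$.  The corrected elements
  $E_v = x_v + \sum_{s(\alpha) = v} x_\alpha$ are orthogonal idempotents with sum $1$, the $x_\alpha$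
  at the arrows satisfy $E_{s(\alpha)} x_\alpha E_{t(\alpha)} = x_\alpha$, and products of two of
  them vanish.  Hence sending $v$ to $E_v$, $\alpha$ to $x_\alpha$ and all longer paths to $0$ is a
  homomorphism from the path algebra; in coordinates it maps $f$ to the vector with entries $f_v$
  and $f_{s(\alpha)} + f_\alpha$, from which multiplicativity is a one-line computation with the
  formulas above (\<open>from_path_algebra_mult\<close>).  It is onto, and its kernel is spanned by the paths of
  length at least two, which is the ideal generated by the paths of length exactly two
  (\<open>rad_square_zero_algebra_recognition\<close>).
\<close>

section \<open>Recognising a radical square zero path algebra\<close>

text \<open>
  A path of length at least two is the product of its first two arrows with the remaining path; the
  trivial path at its start, with a coefficient, supplies the scalar.
\<close>

lemma long_paths_in_Idl:
  fixes Q :: "('v, 'e) pre_digraph" and f :: "'v \<times> 'e list \<Rightarrow>\<^sub>0 'k::field"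
  assumes Q: "fin_digraph Q" and f: "f \<in> carrier (path_algebra Q)"
    and long: "\<forall>x\<in>Poly_Mapping.keys f. 2 \<le> length (snd x)"
  shows "f \<in> Idl\<^bsub>path_algebra Q\<^esub> {Poly_Mapping.single x 1 | x. x \<in> paths Q \<and> length (snd x) = 2}"
    (is "_ \<in> Idl\<^bsub>?R\<^esub> ?G")
proof -
  interpret fin_digraph Q by fact
  interpret R: ring ?R using path_algebra_ring[OF Q] .
  have G: "?G \<subseteq> carrier ?R" by (auto simp: path_algebra_def)
  interpret I: ideal "Idl\<^bsub>?R\<^esub> ?G" ?R by (rule R.genideal_ideal[OF G])
  let ?I = "Idl\<^bsub>?R\<^esub> ?G"
  have "Poly_Mapping.keys f \<subseteq> {x \<in> paths Q. 2 \<le> length (snd x)}"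
    using f long by (auto simp: path_algebra_def)
  then show ?thesis
  proof (rule poly_mapping_span_induct)
    show "0 \<in> ?I" using I.zero_closed by (simp add: path_algebra_def)
  next
    fix f g assume "f \<in> ?I" "g \<in> ?I"
    then show "f + g \<in> ?I" using I.a_closed[of f g] by (simp add: path_algebra_def)
  next
    fix x :: "'v \<times> 'e list" and c :: 'k
    assume x: "x \<in> {x \<in> paths Q. 2 \<le> length (snd x)}"
    obtain u a b p where xu: "x = (u, a # b # p)"
      using x by (cases x; cases "snd x"; cases "tl (snd x)") auto
    obtain v where w: "awalk u (a # b # p) v" using x xu by (auto simp: paths_def)
    have w1: "awalk u [a, b] (head Q b)" and w2: "awalk (head Q b) p v"
      using w by (auto simp: awalk_Cons_iff awalk_Nil_iff)
    have u: "u \<in> verts Q" using w by auto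
    have 1: "Poly_Mapping.single (u, [a, b]) 1 \<in> ?I"
    proof (rule subsetD[OF R.genideal_self[OF G]])
      have "(u, [a, b]) \<in> paths Q" using w1 by (auto simp: paths_def)
      then show "Poly_Mapping.single (u, [a, b]) 1 \<in> ?G"
        by (intro CollectI exI[of _ "(u, [a, b])"]) simp
    qed
    have 2: "Poly_Mapping.single (u, []) c \<in> carrier ?R"
      using u by (auto simp: path_algebra_def paths_def awalk_Nil_iff)
    have 3: "Poly_Mapping.single (head Q b, p) 1 \<in> carrier ?R"
      using w2 by (auto simp: path_algebra_def paths_def)
    have "path_mult Q (path_mult Q (Poly_Mapping.single (u, []) c) (Poly_Mapping.single (u, [a, b]) 1))
        (Poly_Mapping.single (head Q b, p) 1) \<in> ?I"
      using I.I_r_closed[OF I.I_l_closed[OF 1 2] 3] by (simp add: path_algebra_def)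
    then show "Poly_Mapping.single x c \<in> ?I"
      by (simp add: path_mult_single path_term_def path_end_simp xu)
  qed
qed

text \<open>
  The first isomorphism theorem for $KQ$.  Being the image of a ring, $A$ is itself a ring, so the
  associativity of its product comes from that of $KQ$.
\<close>

theorem rad_square_zero_algebra_recognition:
  fixes Q :: "('v, 'e) pre_digraph" and A :: "('k::field, 'a) module"
  assumes Q: "fin_digraph Q"
    and hom: "h \<in> ring_hom (path_algebra Q) A"
    and onto: "h ` carrier (path_algebra Q :: ('k, _) module) = carrier A"
    and zero: "h 0 = \<zero>\<^bsub>A\<^esub>"
    and smult: "\<And>c f. f \<in> carrier (path_algebra Q) \<Longrightarrow> h (c \<odot>\<^bsub>path_algebra Q\<^esub> f) = c \<odot>\<^bsub>A\<^esub> h f"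
    and ker: "\<And>f. f \<in> carrier (path_algebra Q) \<Longrightarrow>
      h f = \<zero>\<^bsub>A\<^esub> \<longleftrightarrow> (\<forall>x\<in>Poly_Mapping.keys f. 2 \<le> length (snd x))"
  shows "algebra_isomorphic A (rad_square_zero_algebra Q)"
proof -
  let ?R = "path_algebra Q :: ('k, _) module"
  let ?G = "{Poly_Mapping.single x (1::'k) | x. x \<in> paths Q \<and> length (snd x) = 2}"
  interpret R: ring ?R using path_algebra_ring[OF Q] .
  have "ring (A \<lparr> carrier := h ` carrier ?R, zero := h \<zero>\<^bsub>?R\<^esub> \<rparr>)"
    by (rule R.ring_hom_imp_img_ring[OF hom])
  then have A: "ring A"
    unfolding onto using zero by (simp add: path_algebra_def)
  interpret h: ring_hom_ring ?R A h
    by (rule ring_hom_ringI2[OF R.ring_axioms A hom])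
  let ?K = "a_kernel ?R A h"
  have K: "?K = {f \<in> carrier ?R. \<forall>x\<in>Poly_Mapping.keys f. 2 \<le> length (snd x)}"
    unfolding a_kernel_def' using ker by blast
  have I: "Idl\<^bsub>?R\<^esub> ?G = ?K"
  proof
    show "Idl\<^bsub>?R\<^esub> ?G \<subseteq> ?K"
    proof (rule R.genideal_minimal[OF h.kernel_is_ideal], safe)
      fix u p assume *: "(u, p) \<in> paths Q" "length (snd (u, p)) = 2"
      then show "Poly_Mapping.single (u, p) 1 \<in> ?K"
        unfolding K by (simp add: path_algebra_def)
    qed
    show "?K \<subseteq> Idl\<^bsub>?R\<^esub> ?G"
      unfolding K using long_paths_in_Idl[OF Q] by blast
  qed
  let ?S = "rad_square_zero_algebra Q :: ('k, _) module"
  have S: "?S = quot_algebra ?R ?K"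
    unfolding rad_square_zero_algebra_def I ..
  \<comment> \<open>Ring isomorphisms do not see the scalar multiplication that \<open>?S\<close> adds to the quotient ring.\<close>
  have iso_cong: "ring_iso A ?S = ring_iso A (?R Quot ?K)"
    unfolding ring_iso_def ring_hom_def S quot_algebra_def by simp
  define q where "q = (\<lambda>X. the_elem (h ` X))"
  have q: "q \<in> ring_iso (?R Quot ?K) A"
    unfolding q_def by (rule h.FactRing_iso_set[OF onto])
  let ?g = "inv_into (carrier (?R Quot ?K)) q"
  have g: "?g \<in> ring_iso A ?S"
    unfolding iso_cong
    by (rule ring_iso_set_sym[OF ideal.quotient_is_ring[OF h.kernel_is_ideal] q])
  have g_h: "?g (h f) = ?K +>\<^bsub>?R\<^esub> f" if f: "f \<in> carrier ?R" for f
  proof -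
    have "?K +>\<^bsub>?R\<^esub> f \<in> carrier (?R Quot ?K)"
      using f by (auto simp: FactRing_def A_RCOSETS_def')
    then have "?g (q (?K +>\<^bsub>?R\<^esub> f)) = ?K +>\<^bsub>?R\<^esub> f"
      using ring_iso_memE(5)[OF q] by (simp add: bij_betw_def)
    then show ?thesis
      by (simp add: q_def h.the_elem_simp[OF f])
  qed
  have "Poly_Mapping.keys (Poly_Mapping.map ((*) c) f) \<subseteq> Poly_Mapping.keys f"
    for c and f :: "'v \<times> 'e list \<Rightarrow>\<^sub>0 'k"
    by (auto simp: in_keys_iff Poly_Mapping.map.rep_eq when_def split: if_splits)
  then have sc: "c \<odot>\<^bsub>?R\<^esub> f \<in> carrier ?R" if "f \<in> carrier ?R" for c f
    using that by (fastforce simp: path_algebra_def)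
  have "?g (c \<odot>\<^bsub>A\<^esub> t) = c \<odot>\<^bsub>?S\<^esub> ?g t" if t: "t \<in> carrier A" for c t
  proof -
    obtain f where f: "f \<in> carrier ?R" "t = h f" using t onto by blast
    \<comment> \<open>As cosets are the fibres of \<open>h\<close>, all members of the union defining the scalar multiple agree.\<close>
    have coset: "?K +>\<^bsub>?R\<^esub> x = {y \<in> carrier ?R. h y = h x}" if "x \<in> carrier ?R" for x
      using h.rcos_eq_homeq[OF that] .
    have "?g (c \<odot>\<^bsub>A\<^esub> t) = ?K +>\<^bsub>?R\<^esub> (c \<odot>\<^bsub>?R\<^esub> f)"
      using g_h[OF sc[OF f(1)], of c] f smult by simp
    also have "\<dots> = (\<Union>x\<in>?K +>\<^bsub>?R\<^esub> f. ?K +>\<^bsub>?R\<^esub> (c \<odot>\<^bsub>?R\<^esub> x))"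
      using f(1) by (auto simp: coset sc smult)
    also have "\<dots> = c \<odot>\<^bsub>?S\<^esub> ?g t"
      using g_h[OF f(1)] f(2) by (simp add: S quot_algebra_def)
    finally show ?thesis .
  qed
  with g show ?thesis
    unfolding algebra_isomorphic_def by blast
qed

text \<open>
  The two coefficient formulas for the product in $KQ$ hold because a path of length at most one
  factors only by splitting off a trivial path.
\<close>

lemma path_mult_lookup_trivial:
  "Poly_Mapping.lookup (path_mult Q f g) (v, [])
    = Poly_Mapping.lookup f (v, []) * Poly_Mapping.lookup g (v, [])"
proof (rule poly_mapping_span_induct[of f UNIV];
    simp add: path_mult_add_left lookup_add distrib_right)
  fix x c
  show "Poly_Mapping.lookup (path_mult Q (Poly_Mapping.single x c) g) (v, [])
      = Poly_Mapping.lookup (Poly_Mapping.single x c) (v, []) * Poly_Mapping.lookup g (v, [])"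
  proof (rule poly_mapping_span_induct[of g UNIV];
      simp add: path_mult_add_right lookup_add distrib_left)
    fix y d
    show "Poly_Mapping.lookup (path_mult Q (Poly_Mapping.single x c) (Poly_Mapping.single y d)) (v, [])
        = Poly_Mapping.lookup (Poly_Mapping.single x c) (v, [])
          * Poly_Mapping.lookup (Poly_Mapping.single y d) (v, [])"
      by (cases x; cases y)
        (auto simp: path_mult_single path_term_def path_end_simp lookup_single when_def)
  qed
qed

lemma path_mult_lookup_arrow:
  "Poly_Mapping.lookup (path_mult Q f g) (v, [a])
    = Poly_Mapping.lookup f (v, []) * Poly_Mapping.lookup g (v, [a])
      + Poly_Mapping.lookup f (v, [a]) * Poly_Mapping.lookup g (head Q a, [])"
proof (rule poly_mapping_span_induct[of f UNIV];
    simp add: path_mult_add_left lookup_add distrib_right)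
  fix x c
  show "Poly_Mapping.lookup (path_mult Q (Poly_Mapping.single x c) g) (v, [a])
      = Poly_Mapping.lookup (Poly_Mapping.single x c) (v, []) * Poly_Mapping.lookup g (v, [a])
        + Poly_Mapping.lookup (Poly_Mapping.single x c) (v, [a]) * Poly_Mapping.lookup g (head Q a, [])"
  proof (rule poly_mapping_span_induct[of g UNIV];
      simp add: path_mult_add_right lookup_add distrib_left)
    fix y d
    show "Poly_Mapping.lookup (path_mult Q (Poly_Mapping.single x c) (Poly_Mapping.single y d)) (v, [a])
      = Poly_Mapping.lookup (Poly_Mapping.single x c) (v, [])
          * Poly_Mapping.lookup (Poly_Mapping.single y d) (v, [a])
        + Poly_Mapping.lookup (Poly_Mapping.single x c) (v, [a])
          * Poly_Mapping.lookup (Poly_Mapping.single y d) (head Q a, [])"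
      by (cases x; cases y)
        (auto simp: path_mult_single path_term_def path_end_simp lookup_single when_def
          append_eq_Cons_conv)
  qed
qed


section \<open>The twisting conditions in coordinates\<close>

lemma tensor_map_nth:
  "tensor_map f g z $ (p, q)
    = (\<Sum>a\<in>UNIV. \<Sum>b\<in>UNIV. z $ (a, b) * (f (axis a 1) $ p * g (axis b 1) $ q))"
  by (simp add: tensor_map_def tensor_lift_def tensor_def)

lemma sum_if_const:
  "(\<Sum>x\<in>S. if P then f x else 0) = (if P then \<Sum>x\<in>S. f x else 0)"
  by simp

lemma if_zero_mult:
  "(if P then a else 0) * b = (if P then a * b else 0 :: 'k::mult_zero)"
  "b * (if P then a else 0) = (if P then b * a else 0 :: 'k::mult_zero)"
  by simp_all

lemma mu_nth: "mu z $ l = z $ (l, l)"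
  by (simp add: mu_def tensor_lift_def axis_def if_zero_mult sum_if_const)

text \<open>
  Multiplication in a product algebra reads off the diagonal, so both sides of each twisting
  condition become explicit sums of products of entries of the $A(i,l)$.
\<close>

lemma tensor_map_id_mu_nth: "tensor_map id mu z $ (k, l) = z $ (k, l, l)"
proof -
  have "tensor_map id mu z $ (k, l)
      = (\<Sum>a\<in>UNIV. \<Sum>b\<in>UNIV. if b = (l, l) then if a = k then z $ (a, b) else 0 else 0)"
    unfolding tensor_map_nth mu_nth by (intro sum.cong refl) (auto simp: axis_def)
  then show ?thesis by simp
qed

lemma tensor_map_mu_id_nth: "tensor_map mu id z $ (k, l) = z $ ((k, k), l)"
proof -
  have "tensor_map mu id z $ (k, l)
      = (\<Sum>a\<in>UNIV. \<Sum>b\<in>UNIV. if b = l then if a = (k, k) then z $ (a, b) else 0 else 0)"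
    unfolding tensor_map_nth mu_nth by (intro sum.cong refl) (auto simp: axis_def)
  then show ?thesis by simp
qed

lemma sum_pair: "(\<Sum>p\<in>UNIV. F p) = (\<Sum>i\<in>UNIV. \<Sum>j\<in>UNIV. F (i::'a::finite, j::'b::finite))"
  by (simp add: sum.cartesian_product split_def)

lemma A_mat_axis: "tw (axis (i, j) 1) $ (k, l) = A_mat tw i l $ k $ j"
  by (simp add: A_mat_def tensor_axis)

lemma tensor_map_tw_id_nth:
  "tensor_map tw id z $ ((k, l), c) = (\<Sum>i\<in>UNIV. \<Sum>j\<in>UNIV. z $ ((i, j), c) * A_mat tw i l $ k $ j)"
proof -
  have "tensor_map tw id z $ ((k, l), c) = (\<Sum>a\<in>UNIV. \<Sum>b\<in>UNIV. if b = c then z $ (a, b) * tw (axis a 1) $ (k, l) else 0)"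
    unfolding tensor_map_nth by (intro sum.cong refl) (auto simp: axis_def)
  then show ?thesis by (simp add: sum_pair A_mat_axis)
qed

lemma tensor_map_id_tw_nth:
  "tensor_map id tw z $ (c, (k, l)) = (\<Sum>i\<in>UNIV. \<Sum>j\<in>UNIV. z $ (c, (i, j)) * A_mat tw i l $ k $ j)"
proof -
  have "tensor_map id tw z $ (c, (k, l)) = (\<Sum>a\<in>UNIV. if a = c then \<Sum>b\<in>UNIV. z $ (a, b) * tw (axis b 1) $ (k, l) else 0)"
    unfolding tensor_map_nth by (intro sum.cong refl) (auto simp: axis_def)
  then show ?thesis by (simp add: sum_pair A_mat_axis)
qed

lemma assoc_nth:
  "assoc_r z $ (a, (b, c)) = z $ ((a, b), c)" "assoc_l z' $ ((a, b), c) = z' $ (a, (b, c))"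
  by (simp_all add: assoc_r_def assoc_l_def)

lemma lin_nth_A_mat:
  assumes "lin tw"
  shows "tw z $ (k, l) = (\<Sum>i\<in>UNIV. \<Sum>j\<in>UNIV. z $ (i, j) * A_mat tw i l $ k $ j)"
  by (subst lin_expand[OF assms]) (simp add: sum_pair A_mat_axis)

context
  fixes tw :: "'k::field ^ ('m::finite \<times> 'n::finite) \<Rightarrow> 'k ^ ('n \<times> 'm)"
  assumes tw: "twisting_map tw"
begin

lemma twisting_lin: "lin tw"
  using tw by (simp add: twisting_map_def)

lemma A_mat_sum_eq_identity: "(\<Sum>i\<in>UNIV. A_mat tw i l $ j $ k) = (if j = k then 1 else 0)"
proof -
  have "tw (tensor 1 (axis k 1)) = tensor (axis k 1) 1"
    using tw by (simp add: twisting_map_def)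
  then have "tw (tensor 1 (axis k 1)) $ (j, l) = tensor (axis k 1) 1 $ (j, l)" by simp
  moreover have "tw (tensor 1 (axis k 1)) $ (j, l)
      = (\<Sum>i\<in>UNIV. \<Sum>k'\<in>UNIV. if k' = k then A_mat tw i l $ j $ k' else 0)"
    unfolding lin_nth_A_mat[OF twisting_lin]
    by (intro sum.cong refl) (auto simp: tensor_def axis_def)
  ultimately show ?thesis by (auto simp: tensor_def axis_def)
qed

lemma A_mat_row_sum: "(\<Sum>k\<in>UNIV. A_mat tw i l $ j $ k) = (if i = l then 1 else 0)"
proof -
  have "tw (tensor (axis i 1) 1) = tensor 1 (axis i 1)"
    using tw by (simp add: twisting_map_def)
  then have "tw (tensor (axis i 1) 1) $ (j, l) = tensor 1 (axis i 1) $ (j, l)" by simp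
  moreover have "tw (tensor (axis i 1) 1) $ (j, l)
      = (\<Sum>i'\<in>UNIV. if i' = i then \<Sum>k'\<in>UNIV. A_mat tw i' l $ j $ k' else 0)"
    unfolding lin_nth_A_mat[OF twisting_lin]
    by (intro sum.cong refl) (auto simp: tensor_def axis_def)
  ultimately show ?thesis by (auto simp: tensor_def axis_def)
qed

text \<open>
  The compatibility of the twisting map with the multiplication of $K^m$, evaluated at
  $e_i \otimes e_{i'} \otimes f_p$.
\<close>

lemma A_mat_orthogonal_idempotents:
  "(\<Sum>k\<in>UNIV. A_mat tw i l $ j $ k * A_mat tw i' l $ k $ p) = (if i = i' then A_mat tw i l $ j $ p else 0)"
proof -
  define z where "z = tensor (tensor (axis i (1::'k)) (axis i' 1)) (axis p (1::'k) :: 'k ^ 'n)"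
  have z: "z $ ((a, b), c) = (if c = p then if b = i' then if a = i then 1 else 0 else 0 else 0)" for a b c
    by (simp add: z_def tensor_def axis_def)
  have "(tw \<circ> tensor_map mu id) z
      = (tensor_map id mu \<circ> assoc_r \<circ> tensor_map tw id \<circ> assoc_l \<circ> tensor_map id tw \<circ> assoc_r) z"
    using tw by (simp add: twisting_map_def)
  then have "tw (tensor_map mu id z) $ (j, l)
      = tensor_map id mu (assoc_r (tensor_map tw id (assoc_l (tensor_map id tw (assoc_r z))))) $ (j, l)"
    by simp
  moreover have "tw (tensor_map mu id z) $ (j, l) = (if i = i' then A_mat tw i l $ j $ p else 0)"
    unfolding lin_nth_A_mat[OF twisting_lin] tensor_map_mu_id_nth z
    by (simp add: if_zero_mult sum_if_const)
  moreover have "tensor_map id mu (assoc_r (tensor_map tw id (assoc_l (tensor_map id tw (assoc_r z))))) $ (j, l)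
     = (\<Sum>k\<in>UNIV. A_mat tw i' l $ k $ p * A_mat tw i l $ j $ k)"
    unfolding tensor_map_id_mu_nth assoc_nth tensor_map_tw_id_nth tensor_map_id_tw_nth z
    by (simp add: if_zero_mult sum_if_const)
  ultimately show ?thesis by (simp add: mult.commute)
qed

text \<open>
  The compatibility with the multiplication of $K^n$, evaluated at $e_i \otimes f_k \otimes f_p$.
  With $B(k,j)_{li} = A(i,l)_{jk}$ the sum is the entry of $B(p,j) B(k,j)$ at $(l,i)$.
\<close>

lemma B_mat_orthogonal_idempotents:
  "(\<Sum>r\<in>UNIV. A_mat tw i r $ j $ k * A_mat tw r l $ j $ p) = (if k = p then A_mat tw i l $ j $ k else 0)"
proof -
  define z where "z = tensor (axis i (1::'k)) (tensor (axis k (1::'k)) (axis p (1::'k)))"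
  have z: "z $ (a, (b, c)) = (if a = i then if b = k then if c = p then 1 else 0 else 0 else 0)" for a b c
    by (simp add: z_def tensor_def axis_def)
  have "(tw \<circ> tensor_map id mu) z
      = (tensor_map mu id \<circ> assoc_l \<circ> tensor_map id tw \<circ> assoc_r \<circ> tensor_map tw id \<circ> assoc_l) z"
    using tw by (simp add: twisting_map_def)
  then have "tw (tensor_map id mu z) $ (j, l)
      = tensor_map mu id (assoc_l (tensor_map id tw (assoc_r (tensor_map tw id (assoc_l z))))) $ (j, l)"
    by simp
  moreover have "tw (tensor_map id mu z) $ (j, l) = (if k = p then A_mat tw i l $ j $ k else 0)"
    unfolding lin_nth_A_mat[OF twisting_lin] tensor_map_id_mu_nth z
    by (simp add: if_zero_mult sum_if_const)
  moreover have "tensor_map mu id (assoc_l (tensor_map id tw (assoc_r (tensor_map tw id (assoc_l z))))) $ (j, l)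
     = (\<Sum>r\<in>UNIV. A_mat tw i r $ j $ k * A_mat tw r l $ j $ p)"
    unfolding tensor_map_mu_id_nth assoc_nth tensor_map_tw_id_nth tensor_map_id_tw_nth z
    by (simp add: if_zero_mult sum_if_const)
  ultimately show ?thesis by simp
qed

end

lemma twisted_mult_nth:
  assumes tw: "lin tw"
  shows "(x \<otimes>\<^bsub>twisted_tensor_product tw\<^esub> y) $ (j, l)
    = (\<Sum>i\<in>UNIV. \<Sum>k\<in>UNIV. A_mat tw i l $ j $ k * (x $ (j, i) * y $ (k, l)))"
proof -
  have lin: "lin (twisted_mu tw)"
    unfolding twisted_mu_def o_def
    by (intro lin_comp[OF _ tensor_map_linear] lin_comp[OF _ assoc_l_linear] assoc_r_linear)
  have "twisted_mu tw (axis ((a, i), (k, b)) 1) = A_mat tw i b $ a $ k *s axis (a, b) 1" for a i k b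
    using twisted_tensor_product_basis[OF tw, of a i k b]
    by (simp add: twisted_tensor_product_def tensor_axis)
  then have "twisted_mu tw (axis ((a, i), (k, b)) 1) $ (j, l)
      = (if a = j then if b = l then A_mat tw i l $ j $ k else 0 else 0)" for a i k b
    by (simp add: axis_def)
  then have "(x \<otimes>\<^bsub>twisted_tensor_product tw\<^esub> y) $ (j, l)
     = (\<Sum>a\<in>UNIV. \<Sum>i\<in>UNIV. \<Sum>k\<in>UNIV. \<Sum>b\<in>UNIV. x $ (a, i) * y $ (k, b) *
         (if a = j then if b = l then A_mat tw i l $ j $ k else 0 else 0))"
    by (simp add: twisted_tensor_product_def lin_expand[OF lin, of "tensor x y"] sum_pair)
      (simp add: tensor_def)
  also have "\<dots> = (\<Sum>a\<in>UNIV. if a = j then \<Sum>i\<in>UNIV. \<Sum>k\<in>UNIV. A_mat tw i l $ j $ k * (x $ (a, i) * y $ (k, l)) else 0)"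
    by (intro sum.cong refl) (simp add: if_zero_mult sum_if_const mult.commute)
  finally show ?thesis by simp
qed


section \<open>Standard twisting maps\<close>

context
  fixes tw :: "'k::field ^ ('m::finite \<times> 'n::finite) \<Rightarrow> 'k ^ ('n \<times> 'm)"
  assumes std: "standard_twisting_map tw"
begin

lemma twisting_std: "twisting_map tw"
  using std by (simp add: standard_twisting_map_def)

lemma A_mat_ll_entry: "A_mat tw l l $ j $ k = (if k = c_idx tw j l then 1 else 0)"
proof -
  have ex: "\<exists>!c. A_mat tw l l $ j $ c = 1" and 01: "A_mat tw l l $ j $ k \<in> {0, 1}"
    using std unfolding standard_twisting_map_def by blast+
  show ?thesis
    using theI'[OF ex] ex 01 unfolding c_idx_def by auto
qed

lemma J_set_iff: "j \<in> J_set tw l \<longleftrightarrow> c_idx tw j l = j"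
  by (auto simp: J_set_def A_mat_ll_entry)

text \<open>
  Idempotence of the $0,1$-matrix $A(l,l)$: the map $j \mapsto c_j(l)$ is a retraction onto $J_l(l)$.
  This makes the targets of the arrows vertices.
\<close>

lemma c_idx_in_J_set: "c_idx tw j l \<in> J_set tw l"
proof -
  let ?c = "c_idx tw j l"
  have "(\<Sum>k\<in>UNIV. A_mat tw l l $ j $ k * A_mat tw l l $ k $ ?c) = 1"
    using A_mat_orthogonal_idempotents[OF twisting_std, of l l j l ?c] by (simp add: A_mat_ll_entry)
  then show ?thesis
    by (simp add: A_mat_ll_entry[of l j] J_set_def if_zero_mult)
qed

text \<open>
  Row $j$ is supported at $j$ and $c_j(l)$, and its entries sum to zero.
\<close>

lemma A_mat_row:
  assumes "i \<noteq> l"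
  shows "A_mat tw i l $ j $ k
    = A_mat tw i l $ j $ j * ((if k = j then 1 else 0) - (if k = c_idx tw j l then 1 else 0))"
proof -
  let ?A = "\<lambda>k. A_mat tw i l $ j $ k" and ?c = "c_idx tw j l"
  have supp: "?A k = 0" if "k \<noteq> j" "k \<noteq> ?c" for k
  proof -
    have "Supp (A_mat tw i l) \<subseteq> Supp (A_mat tw l l) \<union> Supp (mat 1 :: 'k ^ 'n ^ 'n)"
      using std by (simp add: standard_twisting_map_def)
    moreover have "(j, k) \<notin> Supp (A_mat tw l l) \<union> Supp (mat 1 :: 'k ^ 'n ^ 'n)"
      using that by (simp add: Supp_def A_mat_ll_entry mat_def)
    ultimately show ?thesis by (auto simp: Supp_def)
  qed
  have "(\<Sum>k\<in>UNIV. ?A k) = (\<Sum>k\<in>{j, ?c}. ?A k)"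
    by (rule sum.mono_neutral_right) (auto intro: supp)
  then have 0: "(\<Sum>k\<in>{j, ?c}. ?A k) = 0"
    using A_mat_row_sum[OF twisting_std, of i l j] assms by simp
  show ?thesis
  proof (cases "?c = j")
    case True
    with 0 supp[of k] show ?thesis by auto
  next
    case False
    with 0 have "?A ?c = - ?A j" by (simp add: add_eq_0_iff)
    with False supp[of k] show ?thesis by auto
  qed
qed

lemma A_mat_row_J:
  assumes "j \<in> J_set tw l"
  shows "A_mat tw i l $ j $ k = (if i = l \<and> k = j then 1 else 0)"
proof (cases "i = l")
  case True
  then show ?thesis using assms by (simp add: A_mat_ll_entry J_set_iff)
next
  case False
  then show ?thesis
    using A_mat_row[OF False, of j k] assms by (simp add: J_set_iff)
qed

text \<open>
  The diagonal entries at $j$ multiply like the matrices.  If $i = l$ or $i' = l$, both sides are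
  zero.  Otherwise, of the sum for the entry $(j,j)$ of $A(i,l) A(i',l)$ only the term $k = j$
  survives: row $j$ of $A(i,l)$ is supported at $j$ and $c_j(l)$, and the row of $A(i',l)$ at
  $c_j(l) \in J_l(l)$ is zero.
\<close>

lemma A_mat_diag_products:
  assumes "j \<notin> J_set tw l"
  shows "A_mat tw i l $ j $ j * A_mat tw i' l $ j $ j = (if i = i' then A_mat tw i l $ j $ j else 0)"
proof (cases "i = l \<or> i' = l")
  case True
  have "A_mat tw l l $ j $ j = 0"
    using assms by (simp add: A_mat_ll_entry J_set_iff)
  with True show ?thesis by auto
next
  case False
  let ?c = "c_idx tw j l"
  have c: "?c \<noteq> j" using assms J_set_iff by blast
  have "(\<Sum>k\<in>UNIV. A_mat tw i l $ j $ k * A_mat tw i' l $ k $ j)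
      = (\<Sum>k\<in>UNIV. if k = j then A_mat tw i l $ j $ k * A_mat tw i' l $ k $ j else 0)"
  proof (intro sum.cong refl)
    fix k
    have "A_mat tw i l $ j $ k * A_mat tw i' l $ k $ j = 0" if "k \<noteq> j"
    proof (cases "k = ?c")
      case True
      then show ?thesis
        using A_mat_row_J[OF c_idx_in_J_set, of i' l j j] c by simp
    next
      case False
      then show ?thesis
        using A_mat_row[of i l j k] \<open>\<not> (i = l \<or> i' = l)\<close> that by simp
    qed
    then show "A_mat tw i l $ j $ k * A_mat tw i' l $ k $ j
        = (if k = j then A_mat tw i l $ j $ k * A_mat tw i' l $ k $ j else 0)" by simp
  qed
  then show ?thesis
    using A_mat_orthogonal_idempotents[OF twisting_std, of i l j i' j] by simp
qed

text \<open>
  The diagonal entries at $j$ are orthogonal idempotents of the field $K$ with sum $1$, so exactly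
  one of them is $1$ and the others vanish.  Orthogonality is what gives uniqueness in positive
  characteristic.
\<close>

lemma A_mat_diagonal_entry:
  assumes j: "j \<notin> J_set tw l"
  shows "A_mat tw i l $ j $ j = (if i = i_idx tw j l then 1 else 0)"
proof -
  let ?d = "\<lambda>i. A_mat tw i l $ j $ j"
  have 01: "?d i = 0 \<or> ?d i = 1" for i
    using A_mat_diag_products[OF j, of i i] by auto
  have "(\<Sum>i\<in>UNIV. ?d i) = 1"
    using A_mat_sum_eq_identity[OF twisting_std, where l = l and j = j and k = j] by simp
  then have "\<exists>i. ?d i \<noteq> 0"
    by (metis sum.neutral zero_neq_one)
  then obtain i0 where i0: "?d i0 = 1" using 01 by blast
  have uniq: "i = i0" if "?d i = 1" for i
    using A_mat_diag_products[OF j, of i i0] that i0 by (auto split: if_splits)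
  then have "i_idx tw j l = i0"
    unfolding i_idx_def using i0 by (intro the_equality)
  then show ?thesis
    using 01[of i] i0 uniq[of i] by metis
qed

lemma i_idx_neq: "j \<notin> J_set tw l \<Longrightarrow> i_idx tw j l \<noteq> l"
  using A_mat_diagonal_entry[of j l l] by (auto simp: J_set_def)

lemma A_mat_row_not_J:
  assumes j: "j \<notin> J_set tw l"
  shows "A_mat tw i l $ j $ k =
     (if i = l then if k = c_idx tw j l then 1 else 0 else 0)
     + (if i = i_idx tw j l then (if k = j then 1 else 0) - (if k = c_idx tw j l then 1 else 0) else 0)"
proof (cases "i = l")
  case True
  then show ?thesis using i_idx_neq[OF j] by (simp add: A_mat_ll_entry)
next
  case False
  then show ?thesis using A_mat_row[OF False, of j k] A_mat_diagonal_entry[OF j, of i] by simp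
qed

text \<open>
  The sources of the arrows are vertices.  This comes from the second multiplicativity condition:
  in $\sum_r A(i,r)_{jj} A(r,l)_{jj} = A(i,l)_{jj} = 1$ with $i = i(j,l)$ the second factor is
  non-zero for $r = i$ only, which leaves $A(i,i)_{jj} = 1$.
\<close>

lemma i_idx_source:
  assumes j: "j \<notin> J_set tw l"
  shows "j \<in> J_set tw (i_idx tw j l)"
proof -
  let ?i = "i_idx tw j l"
  have "(\<Sum>r\<in>UNIV. A_mat tw ?i r $ j $ j * A_mat tw r l $ j $ j) = 1"
    using B_mat_orthogonal_idempotents[OF twisting_std, of ?i j j l j] by (simp add: A_mat_diagonal_entry[OF j])
  then show ?thesis
    by (simp add: A_mat_diagonal_entry[OF j] J_set_def if_zero_mult)
qed

lemma quiver_fin_digraph: "fin_digraph (quiver tw)"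
  by unfold_locales (auto simp: quiver_def i_idx_source c_idx_in_J_set)

lemma twisted_mult_vertex:
  assumes "v \<in> verts (quiver tw)"
  shows "(x \<otimes>\<^bsub>twisted_tensor_product tw\<^esub> y) $ v = x $ v * y $ v"
proof -
  obtain j l where v: "v = (j, l)" "j \<in> J_set tw l"
    using assms by (auto simp: quiver_def)
  have "(x \<otimes>\<^bsub>twisted_tensor_product tw\<^esub> y) $ v
      = (\<Sum>i\<in>UNIV. \<Sum>k\<in>UNIV. if k = j then if i = l then x $ (j, i) * y $ (k, l) else 0 else 0)"
    unfolding v twisted_mult_nth[OF twisting_lin[OF twisting_std]] A_mat_row_J[OF v(2)]
    by (intro sum.cong refl) simp
  then show ?thesis by (simp add: v)
qed

text \<open>
  Only the indices $i = l$ and $i = i(j,l)$ contribute to the coordinate at $\alpha_{jl}$; they give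
  the first and the second summand.
\<close>

lemma twisted_mult_arrow:
  assumes "a \<in> arcs (quiver tw)"
  shows "(x \<otimes>\<^bsub>twisted_tensor_product tw\<^esub> y) $ a
    = x $ a * y $ head (quiver tw) a
      + x $ tail (quiver tw) a * (y $ a - y $ head (quiver tw) a)"
proof -
  obtain j l where a: "a = (j, l)" "j \<notin> J_set tw l"
    using assms by (auto simp: quiver_def)
  let ?c = "c_idx tw j l" and ?i = "i_idx tw j l"
  have "(x \<otimes>\<^bsub>twisted_tensor_product tw\<^esub> y) $ a
      = (\<Sum>i\<in>UNIV. (if i = l then x $ (j, i) * y $ (?c, l) else 0)
          + (if i = ?i then x $ (j, i) * (y $ (j, l) - y $ (?c, l)) else 0))"
    unfolding a twisted_mult_nth[OF twisting_lin[OF twisting_std]] A_mat_row_not_J[OF a(2)]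
    by (intro sum.cong refl)
      (simp add: distrib_right left_diff_distrib right_diff_distrib sum.distrib sum_subtractf
        if_zero_mult sum_if_const)
  then show ?thesis by (simp add: a quiver_def sum.distrib)
qed


section \<open>The homomorphism from the path algebra\<close>

text \<open>
  The image of $f$ under $v \mapsto x_v + \sum_{s(\alpha) = v} x_\alpha$,
  $\alpha \mapsto x_\alpha$, given by its coordinates: at an arrow $\alpha$, the correction term of the
  idempotent at $s(\alpha)$ adds the coefficient of that vertex to the coefficient of $\alpha$.
\<close>

definition from_path_algebra :: "(('n \<times> 'm) \<times> ('n \<times> 'm) list \<Rightarrow>\<^sub>0 'k) \<Rightarrow> 'k ^ ('n \<times> 'm)" where
  "from_path_algebra f = (\<chi> p. if p \<in> verts (quiver tw) then Poly_Mapping.lookup f (p, [])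
     else Poly_Mapping.lookup f (tail (quiver tw) p, [])
        + Poly_Mapping.lookup f (tail (quiver tw) p, [p]))"

lemma from_path_algebra_vertex:
  "v \<in> verts (quiver tw) \<Longrightarrow> from_path_algebra f $ v = Poly_Mapping.lookup f (v, [])"
  by (simp add: from_path_algebra_def)

lemma from_path_algebra_arrow:
  "a \<in> arcs (quiver tw) \<Longrightarrow> from_path_algebra f $ a
    = Poly_Mapping.lookup f (tail (quiver tw) a, []) + Poly_Mapping.lookup f (tail (quiver tw) a, [a])"
  by (auto simp: from_path_algebra_def quiver_def)

lemma vertex_or_arrow:
  obtains "p \<in> verts (quiver tw)" | "p \<in> arcs (quiver tw)"
  by (cases p) (auto simp: quiver_def)

lemma from_path_algebra_mult:
  "from_path_algebra (path_mult (quiver tw) f g)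
    = from_path_algebra f \<otimes>\<^bsub>twisted_tensor_product tw\<^esub> from_path_algebra g"
proof -
  interpret fin_digraph "quiver tw" by (rule quiver_fin_digraph)
  have "from_path_algebra (path_mult (quiver tw) f g) $ p
      = (from_path_algebra f \<otimes>\<^bsub>twisted_tensor_product tw\<^esub> from_path_algebra g) $ p" for p
  proof (cases p rule: vertex_or_arrow)
    case 1
    then show ?thesis
      by (simp add: from_path_algebra_vertex twisted_mult_vertex path_mult_lookup_trivial)
  next
    case 2
    then show ?thesis
      by (simp add: from_path_algebra_vertex from_path_algebra_arrow twisted_mult_arrow
          path_mult_lookup_trivial path_mult_lookup_arrow algebra_simps)
  qed
  then show ?thesis by (simp add: vec_eq_iff)
qed

lemma from_path_algebra_one:
  "from_path_algebra \<one>\<^bsub>path_algebra (quiver tw)\<^esub> = \<one>\<^bsub>twisted_tensor_product tw\<^esub>"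
proof -
  interpret fin_digraph "quiver tw" by (rule quiver_fin_digraph)
  have "from_path_algebra \<one>\<^bsub>path_algebra (quiver tw)\<^esub> $ p = \<one>\<^bsub>twisted_tensor_product tw\<^esub> $ p" for p
    by (cases p rule: vertex_or_arrow)
      (simp_all add: from_path_algebra_vertex from_path_algebra_arrow path_algebra_def
        twisted_tensor_product_def tensor_def lookup_sum lookup_single when_def)
  then show ?thesis by (simp add: vec_eq_iff)
qed

lemma from_path_algebra_add: "from_path_algebra (f + g) = from_path_algebra f + from_path_algebra g"
  by (simp add: from_path_algebra_def vec_eq_iff lookup_add)

lemma from_path_algebra_smult:
  "from_path_algebra (Poly_Mapping.map ((*) c) f) = c *s from_path_algebra f"
  by (simp add: from_path_algebra_def vec_eq_iff Poly_Mapping.map.rep_eq when_def distrib_left)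

lemma from_path_algebra_surj:
  "\<exists>f \<in> carrier (path_algebra (quiver tw)). from_path_algebra f = t"
proof -
  interpret fin_digraph "quiver tw" by (rule quiver_fin_digraph)
  let ?s = "tail (quiver tw)"
  \<comment> \<open>Inverting $E_v = x_v + \sum_{s(\alpha) = v} x_\alpha$ gives $x_v = E_v - \sum_{s(\alpha) = v} x_\alpha$,
    hence the subtracted vertex coordinate in the coefficient of an arrow.\<close>
  define f where "f = (\<Sum>v\<in>verts (quiver tw). Poly_Mapping.single (v, [] :: ('n \<times> 'm) list) (t $ v))
    + (\<Sum>a\<in>arcs (quiver tw). Poly_Mapping.single (?s a, [a]) (t $ a - t $ ?s a))"
  have "Poly_Mapping.keys f \<subseteq> paths (quiver tw)"
    unfolding f_def
    by (intro order_trans[OF Poly_Mapping.keys_add] Un_least order_trans[OF Poly_Mapping.keys_sum]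
        UN_least) (auto simp: paths_def awalk_Nil_iff awalk_Cons_iff)
  moreover have "from_path_algebra f $ p = t $ p" for p
  proof (cases p rule: vertex_or_arrow)
    case 1
    then show ?thesis
      by (simp add: from_path_algebra_vertex f_def lookup_add lookup_sum lookup_single when_def)
  next
    case 2
    have "?s a = ?s p \<and> a = p \<longleftrightarrow> a = p" for a by auto
    with 2 show ?thesis
      by (simp add: from_path_algebra_arrow f_def lookup_add lookup_sum lookup_single when_def)
  qed
  ultimately show ?thesis
    by (auto simp: path_algebra_def vec_eq_iff)
qed

lemma from_path_algebra_eq_0_iff:
  assumes f: "Poly_Mapping.keys f \<subseteq> paths (quiver tw)"
  shows "from_path_algebra f = 0 \<longleftrightarrow> (\<forall>x\<in>Poly_Mapping.keys f. 2 \<le> length (snd x))"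
proof
  interpret fin_digraph "quiver tw" by (rule quiver_fin_digraph)
  assume 0: "from_path_algebra f = 0"
  have vertex: "Poly_Mapping.lookup f (v, []) = 0" if "v \<in> verts (quiver tw)" for v
    using from_path_algebra_vertex[OF that, of f] 0 by simp
  have arrow: "Poly_Mapping.lookup f (tail (quiver tw) a, [a]) = 0" if "a \<in> arcs (quiver tw)" for a
    using from_path_algebra_arrow[OF that, of f] 0 vertex that by simp
  show "\<forall>x\<in>Poly_Mapping.keys f. 2 \<le> length (snd x)"
  proof
    fix x assume x: "x \<in> Poly_Mapping.keys f"
    obtain u p v where up: "x = (u, p)" "awalk u p v"
      using x f by (cases x) (auto simp: paths_def)
    show "2 \<le> length (snd x)"
    proof (rule ccontr)
      assume "\<not> 2 \<le> length (snd x)"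
      then consider "p = []" | a where "p = [a]"
        using up(1) by (cases p; cases "tl p") auto
      then have "Poly_Mapping.lookup f x = 0"
      proof cases
        case 1
        then show ?thesis using up vertex[of u] by (auto simp: awalk_Nil_iff)
      next
        case (2 a)
        then show ?thesis using up arrow[of a] by (auto simp: awalk_Cons_iff)
      qed
      with x show False by (simp add: in_keys_iff)
    qed
  qed
next
  assume "\<forall>x\<in>Poly_Mapping.keys f. 2 \<le> length (snd x)"
  then have "Poly_Mapping.lookup f (u, []) = 0" "Poly_Mapping.lookup f (u, [a]) = 0" for u a
    by (force simp: in_keys_iff)+
  then show "from_path_algebra f = 0"
    by (simp add: from_path_algebra_def vec_eq_iff)
qed

end

theorem theorem7p4:
  fixes tw :: "'k::field ^ ('m::finite \<times> 'n::finite) \<Rightarrow> 'k ^ ('n \<times> 'm)"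
  assumes "standard_twisting_map tw"
  shows "algebra_isomorphic (twisted_tensor_product tw)
           (rad_square_zero_algebra (quiver tw) :: ('k, _) module)"
proof (rule rad_square_zero_algebra_recognition[OF quiver_fin_digraph[OF assms],
      where h = "from_path_algebra tw"])
  let ?R = "path_algebra (quiver tw) :: ('k, _) module" and ?T = "twisted_tensor_product tw"
  have T: "carrier ?T = UNIV" "add ?T = (+)" "zero ?T = 0" "smult ?T = (*s)"
    by (simp_all add: twisted_tensor_product_def)
  have R: "carrier ?R = {f. Poly_Mapping.keys f \<subseteq> paths (quiver tw)}" "add ?R = (+)"
    "mult ?R = path_mult (quiver tw)" "smult ?R = (\<lambda>c. Poly_Mapping.map ((*) c))"
    by (simp_all add: path_algebra_def)
  show "from_path_algebra tw \<in> ring_hom ?R ?T"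
    by (rule ring_hom_memI)
      (simp_all add: T R from_path_algebra_mult[OF assms] from_path_algebra_one[OF assms]
        from_path_algebra_add[OF assms])
  show "from_path_algebra tw ` carrier ?R = carrier ?T"
  proof
    show "carrier ?T \<subseteq> from_path_algebra tw ` carrier ?R"
    proof
      fix t
      show "t \<in> from_path_algebra tw ` carrier ?R"
        using from_path_algebra_surj[OF assms, of t] by blast
    qed
  qed (simp add: T)
  show "from_path_algebra tw 0 = \<zero>\<^bsub>?T\<^esub>"
    by (simp add: T from_path_algebra_def[OF assms] vec_eq_iff)
  show "from_path_algebra tw (c \<odot>\<^bsub>?R\<^esub> f) = c \<odot>\<^bsub>?T\<^esub> from_path_algebra tw f" for c f
    by (simp add: T R from_path_algebra_smult[OF assms])
  show "from_path_algebra tw f = \<zero>\<^bsub>?T\<^esub> \<longleftrightarrow> (\<forall>x\<in>Poly_Mapping.keys f. 2 \<le> length (snd x))"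
    if "f \<in> carrier ?R" for f
    using from_path_algebra_eq_0_iff[OF assms, of f] that by (simp add: T R)
qed

end
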